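(* For all positive integers $k$ and $n$, $$\Phi_k(n)\le\left(\frac{e\,\pi^2\,\lfloor (k+1)/2\rfloor\,k!}{2^{k+2}}\right)^{1/k} n^{1/k}+\frac{e-1}{e}\,k.$$
   Context: A finite set $\mathcal A$ of non-negative integers is a $B_k$-sequence if all sums $a_1+\dots+a_k$ of $k$ elements of $\mathcal A$ (repetitions allowed) are different, i.e. distinct multisets $\{a_1,\dots,a_k\}$ of elements of $\mathcal A$ have distinct sums. $\Phi_k(n)$ is the maximum size of a $B_k$-sequence contained in $[0,n]$. *)

theory Defs
  imports "HOL-Analysis.Analysis" "HOL-Library.Multiset"
begin

definition B_seq :: "nat \<Rightarrow> nat set \<Rightarrow> bool" where
  "B_seq k A \<longleftrightarrow> finite A \<and>
     (\<forall>M N. set_mset M \<subseteq> A \<and> set_mset N \<subseteq> A \<and> size M = k \<and> size N = k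
        \<and> sum_mset M = sum_mset N \<longrightarrow> M = N)"

definition Phi :: "nat \<Rightarrow> nat \<Rightarrow> nat" where
  "Phi k n = Max {card A | A. A \<subseteq> {0..n} \<and> B_seq k A}"

end

theory Submission
  imports Defs
begin

text \<open>
  Let \<open>A \<subseteq> [0,n]\<close> be a \<open>B\<^sub>k\<close>-sequence with \<open>a\<close> elements, \<open>m = \<lfloor>k/2\<rfloor>\<close> and \<open>h = \<lceil>k/2\<rceil>\<close>.
  For disjoint \<open>P, Q \<subseteq> A\<close> with \<open>|P| = m\<close> and \<open>|Q| = k - m\<close> the differences \<open>\<Sum>P - \<Sum>Q\<close> are
  pairwise distinct. For a fixed union \<open>P \<union> Q\<close>, nearly balanced random signs are negatively
  correlated, so after translating \<open>A\<close> into \<open>[-n/2, n/2]\<close> the mean square of the differences is of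
  order \<open>k n\<^sup>2\<close>; on the other hand, \<open>N\<close> distinct integers have variance at least \<open>(N\<^sup>2 - 1)/12\<close>.
  Hence \<open>binom(a,k) binom(k,m)\<close> is \<open>O(n \<surd>k)\<close>, and \<open>4\<^sup>k \<le> 4 h binom(k,m)\<^sup>2\<close> turns this into
  \<open>2\<^sup>k binom(a,k) \<le> 6 h n\<close> for \<open>a \<ge> k\<close>; note \<open>6 \<le> e \<pi>\<^sup>2 / 4\<close>.
  The linear term comes from \<open>(a - (1 - 1/e) k)\<^sup>k \<le> k! binom(a,k)\<close>, valid for \<open>a \<ge> k\<close>.
  If \<open>(1 - 1/e) k < a < k\<close>, counting all sums of \<open>k\<close> elements already gives \<open>2\<^sup>k \<le> 6 h n\<close>, and
  \<open>(a - (1 - 1/e) k)\<^sup>k \<le> (k/e)\<^sup>k \<le> k!\<close>.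
\<close>

section \<open>Variance of distinct integers\<close>

text \<open>Induction removing the least and the largest element: they are at least
  \<open>card X - 1\<close> apart, so for any centre \<open>c\<close> they contribute at least half
  the square of that, which is exactly the increment of the closed form.\<close>

lemma sum_square_distinct_integers_ge:
  fixes X :: "int set" and c :: real
  assumes "finite X"
  shows "real (card X) * (real (card X) ^ 2 - 1) / 12 \<le> (\<Sum>s\<in>X. (real_of_int s - c)\<^sup>2)"
  using assms
proof (induction "card X" arbitrary: X rule: less_induct)
  case less
  show ?case
  proof (cases "card X \<le> 1")
    case True
    then have "card X = 0 \<or> card X = 1" by linarith
    then show ?thesis by (auto intro!: sum_nonneg)
  next
    case False
    define p q where "p = Min X" and "q = Max X"
    have ne: "X \<noteq> {}" using False by auto
    have pX: "p \<in> X" and qX: "q \<in> X"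
      using less.prems ne by (auto simp: p_def q_def)
    have sub: "X \<subseteq> {p..q}" using less.prems by (auto simp: p_def q_def)
    have "card X \<le> card {p..q}" by (rule card_mono) (use sub in auto)
    then have le: "int (card X) \<le> q - p + 1" using False by auto
    with False have pq: "p < q" by linarith
    define Y where "Y = X - {p, q}"
    have cY: "card X = card Y + 2"
      using False pX qX pq less.prems unfolding Y_def by (subst card_Diff_subset) auto
    have split: "(\<Sum>s\<in>X. (real_of_int s - c)\<^sup>2) =
      (\<Sum>s\<in>Y. (real_of_int s - c)\<^sup>2) + ((p - c)\<^sup>2 + (q - c)\<^sup>2)"
      using sum.subset_diff[of "{p,q}" X "\<lambda>s. (real_of_int s - c)\<^sup>2"] less.prems pX qX pq
      by (simp add: Y_def)
    have IH: "real (card Y) * (real (card Y) ^ 2 - 1) / 12 \<le> (\<Sum>s\<in>Y. (real_of_int s - c)\<^sup>2)"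
      using less.hyps[of Y] cY less.prems by (simp add: Y_def)
    have "real (card Y) + 1 \<le> real_of_int (q - p)" using le cY by linarith
    then have "(real (card Y) + 1)\<^sup>2 \<le> (real_of_int (q - p))\<^sup>2" by (intro power_mono) auto
    \<comment> \<open>Twice the right side equals
      \<open>((p - c) + (q - c))^2 + (q - p)^2\<close>.\<close>
    moreover have "(real_of_int (q - p))\<^sup>2 / 2 \<le> (p - c)\<^sup>2 + (q - c)\<^sup>2"
      using zero_le_power2[of "(p - c) + (q - c)"] by (simp add: power2_eq_square field_simps)
    ultimately have "(real (card Y) + 1)\<^sup>2 / 2 \<le> (p - c)\<^sup>2 + (q - c)\<^sup>2" by linarith
    moreover have "real (card X) * (real (card X) ^ 2 - 1) / 12 =
       real (card Y) * (real (card Y) ^ 2 - 1) / 12 + (real (card Y) + 1)\<^sup>2 / 2"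
      by (simp add: cY power2_eq_square field_simps)
    ultimately show ?thesis using IH split by linarith
  qed
qed

section \<open>Second moment of random signed sums over a fixed set\<close>

text \<open>Deleting \<open>i\<close> leaves an arbitrary \<open>(m - 1)\<close>-subset of
  \<open>T - {i, j}\<close>. The count determines the correlation of two signs.\<close>

lemma card_separating_subsets:
  assumes "finite T" "i \<in> T" "j \<in> T" "i \<noteq> j" "m \<ge> 1"
  shows "card {P. P \<subseteq> T \<and> card P = m \<and> i \<in> P \<and> j \<notin> P} = (card T - 2) choose (m - 1)"
proof -
  have "bij_betw (insert i) {R. R \<subseteq> T - {i, j} \<and> card R = m - 1}
          {P. P \<subseteq> T \<and> card P = m \<and> i \<in> P \<and> j \<notin> P}"
  proof (rule bij_betw_byWitness[where f' = "\<lambda>P. P - {i}"])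
    show "insert i ` {R. R \<subseteq> T - {i, j} \<and> card R = m - 1}
            \<subseteq> {P. P \<subseteq> T \<and> card P = m \<and> i \<in> P \<and> j \<notin> P}"
    proof clarify
      fix R assume "R \<subseteq> T - {i, j}" "card R = m - 1"
      moreover from this have "finite R" "i \<notin> R" using assms(1) finite_subset by blast+
      ultimately show "insert i R \<subseteq> T \<and> card (insert i R) = m \<and> i \<in> insert i R \<and> j \<notin> insert i R"
        using assms by auto
    qed
    show "(\<lambda>P. P - {i}) ` {P. P \<subseteq> T \<and> card P = m \<and> i \<in> P \<and> j \<notin> P}
            \<subseteq> {R. R \<subseteq> T - {i, j} \<and> card R = m - 1}"
      using assms by (auto simp: card_Diff_singleton)
  qed auto
  then have "card {P. P \<subseteq> T \<and> card P = m \<and> i \<in> P \<and> j \<notin> P} =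
      card {R. R \<subseteq> T - {i, j} \<and> card R = m - 1}"
    by (simp add: bij_betw_same_card)
  also have "\<dots> = card (T - {i, j}) choose (m - 1)"
    using assms by (intro n_subsets) auto
  also have "card (T - {i, j}) = card T - 2"
    using assms by (subst card_Diff_subset) auto
  finally show ?thesis .
qed

text \<open>\<open>2 * sum x P - sum x T\<close> carries the sign +1 on \<open>P\<close> and -1 on
  \<open>T - P\<close>. When the square is expanded and summed over \<open>P\<close>, the diagonal
  sign correlations are \<open>C\<close> and all others are \<open>C - D\<close>.\<close>

lemma sum_square_signed_sums:
  fixes x :: "'a \<Rightarrow> real"
  assumes T: "finite T" and m: "m \<ge> 1"
  defines "C \<equiv> real (card T choose m)"
    and "D \<equiv> 4 * real ((card T - 2) choose (m - 1))"
  shows "(\<Sum>P\<in>{P. P \<subseteq> T \<and> card P = m}. (2 * sum x P - sum x T)\<^sup>2) =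
           D * (\<Sum>i\<in>T. (x i)\<^sup>2) + (C - D) * (sum x T)\<^sup>2"
proof -
  define F where "F = {P. P \<subseteq> T \<and> card P = m}"
  define s :: "'a set \<Rightarrow> 'a \<Rightarrow> real" where "s = (\<lambda>P i. if i \<in> P then 1 else -1)"
  have F: "finite F" "real (card F) = C"
    using T by (simp_all add: F_def C_def n_subsets)
  have corr: "(\<Sum>P\<in>F. s P i * s P j) = (if i = j then C else C - D)"
    if ij: "i \<in> T" "j \<in> T" for i j
  proof (cases "i = j")
    case True
    have "(\<Sum>P\<in>F. s P i * s P j) = (\<Sum>P\<in>F. 1)"
      by (rule sum.cong) (auto simp: s_def True)
    then show ?thesis using F True by simp
  next
    case False
    \<comment> \<open>The product is -1 exactly when \<open>P\<close> separates \<open>i\<close>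
      from \<open>j\<close>; each of the two orders occurs \<open>D / 4\<close> times.\<close>
    have eq: "s P i * s P j = 1 - 2 * of_bool (i \<in> P \<and> j \<notin> P) - 2 * of_bool (j \<in> P \<and> i \<notin> P)" for P
      by (auto simp: s_def)
    have cnt: "(\<Sum>P\<in>F. (of_bool (a \<in> P \<and> b \<notin> P) :: real)) = D / 4"
      if "a \<in> T" "b \<in> T" "a \<noteq> b" for a b
    proof -
      have "F \<inter> {P. a \<in> P \<and> b \<notin> P} = {P. P \<subseteq> T \<and> card P = m \<and> a \<in> P \<and> b \<notin> P}"
        by (auto simp: F_def)
      then show ?thesis
        using card_separating_subsets[OF T that m] F(1) by (simp add: D_def sum_of_bool_eq)
    qed
    have "(\<Sum>P\<in>F. s P i * s P j) = C - D"
      unfolding eq sum_subtractf sum_distrib_left[symmetric]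
      using cnt[OF ij False] cnt[OF ij(2,1)] False F by simp
    then show ?thesis using False by simp
  qed
  have signed: "2 * sum x P - sum x T = (\<Sum>i\<in>T. s P i * x i)" if "P \<in> F" for P
  proof -
    have PT: "P \<subseteq> T" using that by (simp add: F_def)
    have "(\<Sum>i\<in>T. s P i * x i) = (\<Sum>i\<in>T - P. s P i * x i) + (\<Sum>i\<in>P. s P i * x i)"
      by (rule sum.subset_diff[OF PT T])
    also have "\<dots> = - sum x (T - P) + sum x P"
      by (simp add: s_def sum_negf)
    also have "sum x T = sum x (T - P) + sum x P"
      by (rule sum.subset_diff[OF PT T])
    ultimately show ?thesis by simp
  qed
  have "(\<Sum>P\<in>F. (2 * sum x P - sum x T)\<^sup>2) =
      (\<Sum>P\<in>F. \<Sum>i\<in>T. \<Sum>j\<in>T. s P i * s P j * (x i * x j))"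
  proof (rule sum.cong)
    fix P assume "P \<in> F"
    show "(2 * sum x P - sum x T)\<^sup>2 = (\<Sum>i\<in>T. \<Sum>j\<in>T. s P i * s P j * (x i * x j))"
      unfolding signed[OF \<open>P \<in> F\<close>] power2_eq_square sum_product
      by (intro sum.cong refl) (simp add: mult_ac)
  qed simp
  also have "\<dots> = (\<Sum>i\<in>T. \<Sum>j\<in>T. (\<Sum>P\<in>F. s P i * s P j) * (x i * x j))"
    unfolding sum_distrib_right
    by (subst sum.swap) (intro sum.cong refl, rule sum.swap)
  also have "\<dots> = (\<Sum>i\<in>T. \<Sum>j\<in>T. (if i = j then D * (x i * x j) else 0) + (C - D) * (x i * x j))"
    by (intro sum.cong refl) (auto simp: corr algebra_simps)
  also have "\<dots> = D * (\<Sum>i\<in>T. (x i)\<^sup>2) + (C - D) * (sum x T)\<^sup>2"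
    using T by (simp add: sum.distrib power2_eq_square sum_product flip: sum_distrib_left)
  finally show ?thesis by (simp add: F_def)
qed

section \<open>Lower bounds for binomial coefficients\<close>

text \<open>Consecutive central coefficients have ratio \<open>2 * (2 * m + 1) / (m + 1)\<close>;
  the induction closes because \<open>4 * m * (m + 1) \<le> (2 * m + 1)^2\<close>.\<close>

lemma central_binomial_square_ge:
  assumes "m \<ge> 1"
  shows "(16::real) ^ m \<le> 4 * real m * (real (2 * m choose m))\<^sup>2"
  using assms
proof (induction m rule: nat_induct_at_least)
  case base
  show ?case by (simp add: numeral_2_eq_2)
next
  case (Suc m)
  define c d where "c = real (2 * m choose m)" and "d = real (2 * Suc m choose Suc m)"
  have "Suc m * (2 * Suc m choose Suc m) = 2 * (2 * m + 1) * (2 * m choose m)"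
  proof -
    have a: "Suc m * (2 * Suc m choose Suc m) = 2 * Suc m * (Suc (2 * m) choose m)"
      using Suc_times_binomial[of m "Suc (2 * m)"] by simp
    have "Suc (2 * m) choose m = Suc (2 * m) choose Suc m"
      by (subst binomial_symmetric) auto
    then have "Suc m * (Suc (2 * m) choose m) = Suc (2 * m) * (2 * m choose m)"
      using Suc_times_binomial[of m "2 * m"] by simp
    with a show ?thesis by (simp add: algebra_simps)
  qed
  then have "real (Suc m * (2 * Suc m choose Suc m)) = real (2 * (2 * m + 1) * (2 * m choose m))"
    by (simp only:)
  then have r: "(real m + 1) * d = 2 * (2 * real m + 1) * c"
    unfolding of_nat_mult c_def d_def by (simp add: algebra_simps)
  have "16 ^ Suc m * (real m + 1) \<le> 16 * (real m + 1) * (4 * real m * c\<^sup>2)"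
  proof -
    have "16 * (real m + 1) * 16 ^ m \<le> 16 * (real m + 1) * (4 * real m * c\<^sup>2)"
      using Suc.IH unfolding c_def by (intro mult_left_mono) auto
    then show ?thesis by (simp only: power_Suc mult_ac)
  qed
  also have "\<dots> \<le> 4 * (2 * (2 * real m + 1) * c)\<^sup>2"
    using zero_le_power2[of c] by (simp add: power2_eq_square algebra_simps)
  also have "\<dots> = 4 * (real m + 1) * d\<^sup>2 * (real m + 1)"
    unfolding r[symmetric] by (simp add: power2_eq_square)
  finally have "16 ^ Suc m \<le> 4 * (real m + 1) * d\<^sup>2"
    by (rule mult_right_le_imp_le) simp
  then show ?case by (simp add: d_def add.commute)
qed

text \<open>For odd \<open>k\<close> the middle coefficient is half the central one of row
  \<open>k + 1\<close>; rounding up in \<open>(k + 1) div 2\<close> fits both parities.\<close>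

lemma middle_binomial_square_ge:
  assumes "k \<ge> 1"
  shows "(4::real) ^ k \<le> 4 * real ((k + 1) div 2) * (real (k choose (k div 2)))\<^sup>2"
proof (cases "even k")
  case True
  then obtain m where m: "k = 2 * m" by blast
  with assms central_binomial_square_ge[of m] show ?thesis by (simp add: power_mult)
next
  case False
  then obtain m where m: "k = 2 * m + 1" by (elim oddE)
  have "Suc m * (2 * Suc m choose Suc m) = 2 * Suc m * (Suc (2 * m) choose m)"
    using Suc_times_binomial[of m "Suc (2 * m)"] by simp
  then have "2 * Suc m choose Suc m = 2 * (Suc (2 * m) choose m)" 
    by (metis mult.assoc mult.left_commute mult_left_cancel nat.distinct(1))
  then have "real (2 * Suc m choose Suc m) = 2 * real (k choose m)" by (simp add: m)
  with central_binomial_square_ge[of "Suc m"]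
  have "16 ^ Suc m \<le> 4 * real (Suc m) * (2 * real (k choose m))\<^sup>2" by (simp only: le_add1 Suc_eq_plus1 le_add2)
  moreover have "(16::real) ^ Suc m = 4 * 4 ^ k"
    by (simp add: m power_mult)
  ultimately show ?thesis by (simp add: m power_mult_distrib)
qed

text \<open>
  In the induction step put \<open>u = y + k/e\<close> and \<open>s = 1/(e u) \<le> 1/k\<close>; since \<open>((1 + s)\<^bsup>k+1\<^esup> - 1)/s\<close> is
  increasing in \<open>s\<close>, it suffices to look at \<open>s = 1/k\<close>, where \<open>(1 + 1/k)\<^sup>k \<le> e\<close>.
\<close>

lemma rising_product_ge:
  fixes y k :: nat
  shows "(real y + real k / exp 1) ^ k \<le> fact k * real ((y + k) choose k)"
proof (induction k)
  case 0
  show ?case by simp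
next
  case (Suc k)
  have step: "fact (Suc k) * real ((y + Suc k) choose Suc k) =
      (fact k * real ((y + k) choose k)) * (real y + real k + 1)"
  proof -
    have "real (Suc k * (Suc (y + k) choose Suc k)) = real (Suc (y + k) * ((y + k) choose k))"
      by (simp only: Suc_times_binomial)
    then have "(real k + 1) * real (Suc (y + k) choose Suc k) = (real y + real k + 1) * real ((y + k) choose k)"
      unfolding of_nat_mult by (simp only: of_nat_Suc of_nat_add add_ac)
    then have "fact k * ((real k + 1) * real (Suc (y + k) choose Suc k)) =
        fact k * ((real y + real k + 1) * real ((y + k) choose k))" by simp
    then show ?thesis
      by (simp only: fact_Suc of_nat_Suc add_Suc_right mult_ac add_ac)
  qed
  define e where "e = exp (1::real)"
  have e: "e > 1" unfolding e_def by simp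
  show ?case
  \<comment> \<open>For \<open>k = 0\<close> the divisor \<open>u\<close> used below could
    vanish.\<close>
  proof (cases "k = 0")
    case True
    have "1 / e \<le> 1" using e by simp
    then show ?thesis using True by (simp add: e_def)
  next
    case False
    define u where "u = real y + real k / e"
    define s where "s = 1 / (e * u)"
    have u: "u > 0" "u \<ge> real k / e" using False e by (auto simp: u_def add_nonneg_pos)
    then have "real k \<le> e * u" using e by (simp add: field_simps)
    then have s: "s \<ge> 0" "s \<le> 1 / real k"
      using False e u by (auto simp: s_def intro!: divide_left_mono)
    have bound: "(1 + s) ^ Suc k \<le> 1 + s * (real k * (e - 1) + e)"
    proof -
      \<comment> \<open>As a geometric sum, the quotient by \<open>s\<close> is monotone in
        \<open>s\<close> term by term.\<close>
      have "(1 + s) ^ Suc k - 1 = s * (\<Sum>j<Suc k. (1 + s) ^ j)"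
        by (subst power_diff_1_eq) (auto)
      also have "\<dots> \<le> s * (\<Sum>j<Suc k. (1 + 1 / real k) ^ j)"
        using s by (intro mult_left_mono sum_mono power_mono) auto
      also have "(\<Sum>j<Suc k. (1 + 1 / real k) ^ j) = real k * ((1 + 1 / real k) ^ Suc k - 1)"
        using False by (subst power_diff_1_eq) (auto)
      also have "s * \<dots> \<le> s * (real k * (e * (1 + 1 / real k) - 1))"
      proof -
        have "(1 + 1 / real k) ^ k \<le> e"
          using exp_ge_one_plus_x_over_n_power_n[of k 1] False by (simp add: e_def)
        then have "(1 + 1 / real k) ^ Suc k \<le> e * (1 + 1 / real k)"
          using mult_right_mono[of "(1 + 1 / real k) ^ k" e "1 + 1 / real k"] by (simp add: mult.commute)
        then show ?thesis using s by (intro mult_left_mono) auto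
      qed
      also have "real k * (e * (1 + 1 / real k) - 1) = real k * (e - 1) + e"
        using False by (simp add: field_simps)
      finally show ?thesis by simp
    qed
    have us: "u * s = 1 / e" using u by (simp add: s_def)
    then have "real y + real (Suc k) / e = u * (1 + s)"
      by (simp add: u_def distrib_left add_divide_distrib)
    then have "(real y + real (Suc k) / e) ^ Suc k = u ^ Suc k * (1 + s) ^ Suc k"
      by (simp only: power_mult_distrib)
    also have "\<dots> \<le> u ^ Suc k * (1 + s * (real k * (e - 1) + e))"
      using bound u by (intro mult_left_mono) auto
    also have "\<dots> = u ^ k * (real y + real k + 1)"
    proof -
      \<comment> \<open>Since \<open>u * s = 1 / e\<close>, the bound collapses to exactly
        \<open>y + k + 1\<close>, the new factor of the rising product.\<close>
      have "u * (1 + s * (real k * (e - 1) + e)) = u + (real k * (e - 1) + e) / e"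
        using us by (simp only: distrib_left mult.assoc[symmetric] mult_1_right times_divide_eq_left
            mult_1_left add_divide_distrib)
      also have "\<dots> = real y + real k + 1"
        using e by (simp add: u_def field_simps)
      finally show ?thesis by (simp add: mult.assoc mult.left_commute)
    qed
    also have "\<dots> \<le> (fact k * real ((y + k) choose k)) * (real y + real k + 1)"
      using Suc.IH by (intro mult_right_mono) (auto simp: u_def e_def)
    finally show ?thesis unfolding step by (simp add: e_def)
  qed
qed

text \<open>As \<open>k \<le> 2 * h\<close>, the first and the last \<open>h + 1\<close> entries
  cover row \<open>k\<close>, and by symmetry both groups have the same sum. Weighting entry
  \<open>i\<close> by \<open>h choose (h - i)\<close>, which is at least 1, produces a Vandermonde
  convolution.\<close>

lemma two_power_le_binomial:
  assumes "h \<le> k" "k \<le> 2 * h"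
  shows "2 ^ k \<le> 2 * ((k + h) choose h)"
proof -
  have "(\<Sum>i\<in>{k - h..k}. k choose i) = (\<Sum>i\<le>h. k choose i)"
    using assms
    by (intro sum.reindex_bij_witness[where i = "\<lambda>i. k - i" and j = "\<lambda>i. k - i"])
       (auto simp flip: binomial_symmetric)
  moreover have "(\<Sum>i\<le>k. k choose i) \<le> (\<Sum>i\<in>{..h} \<union> {k - h..k}. k choose i)"
    using assms by (intro sum_mono2) auto
  moreover have "(\<Sum>i\<in>{..h} \<union> {k - h..k}. k choose i) \<le>
      (\<Sum>i\<le>h. k choose i) + (\<Sum>i\<in>{k - h..k}. k choose i)"
    by (simp add: sum_Un_nat)
  ultimately have "2 ^ k \<le> 2 * (\<Sum>i\<le>h. k choose i)"
    by (simp add: choose_row_sum)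
  moreover have "(\<Sum>i\<le>h. k choose i) \<le> (\<Sum>i\<le>h. (k choose i) * (h choose (h - i)))"
    by (intro sum_mono) (simp add: Suc_leI)
  ultimately show ?thesis by (simp add: vandermonde)
qed

section \<open>Counting sums and differences of a B_k-sequence\<close>

text \<open>Pigeonhole: the left side counts the multisets of size \<open>k\<close> over
  \<open>A\<close>, whose distinct sums lie in \<open>[0, k * n]\<close>.\<close>

lemma card_multisets_le:
  assumes "B_seq k A" "A \<subseteq> {0..n}"
  shows "(card A + k - 1) choose k \<le> k * n + 1"
proof -
  have fin: "finite A" using assms by (simp add: B_seq_def)
  have "inj_on sum_mset (multisets_of_size A k)"
    using assms(1) unfolding inj_on_def multisets_of_size_def B_seq_def by blast
  moreover have "sum_mset ` multisets_of_size A k \<subseteq> {0..k * n}"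
  proof clarsimp
    fix M assume M: "M \<in> multisets_of_size A k"
    have "\<forall>x\<in>#M. x \<le> n"
      using M assms(2) by (auto simp: multisets_of_size_def)
    then have "sum_mset M \<le> size M * n"
      by (induction M) auto
    then show "sum_mset M \<le> k * n" using M by (simp add: multisets_of_size_def)
  qed
  ultimately have "card (multisets_of_size A k) \<le> card {0..k * n}"
    by (intro card_inj_on_le) auto
  then show ?thesis using fin by (simp add: card_multisets_of_size)
qed

text \<open>Disjoint sets \<open>P\<close> and \<open>Q\<close> are encoded by their union
  \<open>T\<close> together with \<open>P\<close>, so that one can average over \<open>P\<close>
  with \<open>T\<close> fixed.\<close>

definition split_subsets :: "'a set \<Rightarrow> nat \<Rightarrow> nat \<Rightarrow> ('a set \<times> 'a set) set" where
  "split_subsets A k m =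
     (SIGMA T:{T. T \<subseteq> A \<and> card T = k}. {P. P \<subseteq> T \<and> card P = m})"

text \<open>This is the sum over \<open>P\<close> minus the sum over \<open>T - P\<close>, in the
  shape evaluated by \<open>sum_square_signed_sums\<close>.\<close>

definition signed_sum :: "nat set \<times> nat set \<Rightarrow> int" where
  "signed_sum = (\<lambda>(T, P). 2 * (\<Sum>x\<in>P. int x) - (\<Sum>x\<in>T. int x))"

lemma signed_sum_eq:
  assumes "finite T" "P \<subseteq> T"
  shows "signed_sum (T, P) = int (\<Sum>P) - int (\<Sum>(T - P))"
  using sum.subset_diff[OF assms(2,1), of int] by (simp add: signed_sum_def)

lemma finite_split_subsets: "finite A \<Longrightarrow> finite (split_subsets A k m)"
  unfolding split_subsets_def by (rule finite_SigmaI) (auto simp: finite_subset)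

lemma card_split_subsets:
  assumes "finite A"
  shows "card (split_subsets A k m) = (card A choose k) * (k choose m)"
proof -
  have "card (split_subsets A k m) = (\<Sum>T\<in>{T. T \<subseteq> A \<and> card T = k}. card {P. P \<subseteq> T \<and> card P = m})"
    unfolding split_subsets_def using assms
    by (intro card_SigmaI) (auto simp: finite_subset)
  also have "\<dots> = (\<Sum>T\<in>{T. T \<subseteq> A \<and> card T = k}. k choose m)"
    using assms by (intro sum.cong refl) (auto simp: n_subsets finite_subset)
  finally show ?thesis using assms by (simp add: n_subsets)
qed

text \<open>Moving the subtracted parts across turns equal differences into equal sums of two
  multisets of size \<open>m + (k - m) = k\<close>, to which the B_k property applies.\<close>

lemma inj_on_signed_sum:
  assumes B: "B_seq k A" and mk: "m \<le> k"
  shows "inj_on signed_sum (split_subsets A k m)"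
proof (rule inj_onI)
  fix u v assume u: "u \<in> split_subsets A k m" and v: "v \<in> split_subsets A k m"
    and eq: "signed_sum u = signed_sum v"
  obtain T P U Q where [simp]: "u = (T, P)" "v = (U, Q)" by (metis surj_pair)
  have fin: "finite A" using B by (simp add: B_seq_def)
  have T: "T \<subseteq> A" "card T = k" "P \<subseteq> T" "card P = m" "finite T" "finite P"
    and U: "U \<subseteq> A" "card U = k" "Q \<subseteq> U" "card Q = m" "finite U" "finite Q"
    using u v fin by (auto simp: split_subsets_def) (meson finite_subset)+
  define M N where "M = mset_set P + mset_set (U - Q)" and "N = mset_set Q + mset_set (T - P)"
  have "size M = k" "size N = k"
    using T U mk by (auto simp: M_def N_def card_Diff_subset)
  moreover have "set_mset M \<subseteq> A" "set_mset N \<subseteq> A"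
    using T U by (auto simp: M_def N_def)
  moreover have "sum_mset M = sum_mset N"
  proof -
    have "int (\<Sum>P) + int (\<Sum>(U - Q)) = int (\<Sum>Q) + int (\<Sum>(T - P))"
      using eq signed_sum_eq[OF T(5,3)] signed_sum_eq[OF U(5,3)] by simp
    then have "\<Sum>P + \<Sum>(U - Q) = \<Sum>Q + \<Sum>(T - P)" by linarith
    then show ?thesis by (simp add: M_def N_def sum_unfold_sum_mset)
  qed
  ultimately have MN: "M = N" using B unfolding B_seq_def by blast
  \<comment> \<open>Since \<open>P\<close> is disjoint from \<open>T - P\<close> and
    \<open>Q\<close> from \<open>U - Q\<close>, these multiplicities force first
    \<open>P = Q\<close> and then \<open>T = U\<close>.\<close>
  have cnt: "(of_bool (x \<in> P) :: nat) + of_bool (x \<in> U - Q) = of_bool (x \<in> Q) + of_bool (x \<in> T - P)" for x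
    using arg_cong[OF MN, of "\<lambda>M. count M x"] T U by (simp add: M_def N_def count_mset_set' of_bool_def)
  have "x \<in> P \<longleftrightarrow> x \<in> Q" for x using cnt[of x] by (auto split: if_splits simp: of_bool_def)
  moreover have "x \<in> T \<longleftrightarrow> x \<in> U" for x using cnt[of x] T U by (auto split: if_splits simp: of_bool_def)
  ultimately show "u = v" by auto
qed

text \<open>Pigeonhole for the differences; this crude count serves the cases
  \<open>k \<le> 2\<close>.\<close>

lemma card_signed_sums_le:
  assumes B: "B_seq k A" and A: "A \<subseteq> {0..n}" and mk: "m \<le> k"
  shows "(card A choose k) * (k choose m) \<le> k * n + 1"
proof -
  have fin: "finite A" using B by (simp add: B_seq_def)
  have "signed_sum ` split_subsets A k m \<subseteq> {- int ((k - m) * n)..int (m * n)}"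
  proof clarify
    fix T P assume "(T, P) \<in> split_subsets A k m"
    then have T: "T \<subseteq> A" "card T = k" "P \<subseteq> T" "card P = m" "finite T" "finite P"
      using fin by (auto simp: split_subsets_def intro: finite_subset)
    have n: "x \<le> n" if "x \<in> T" for x using that T A by auto
    have "\<Sum>P \<le> card P * n" using T n by (intro sum_bounded_above[where K = n, simplified]) auto
    moreover have "\<Sum>(T - P) \<le> card (T - P) * n"
      using T n by (intro sum_bounded_above[where K = n, simplified]) auto
    moreover have "card (T - P) = k - m" using T by (simp add: card_Diff_subset)
    ultimately have "int (\<Sum>P) \<le> int (m * n)" "int (\<Sum>(T - P)) \<le> int ((k - m) * n)"
      using T(4) by (simp_all only: of_nat_le_iff)
    moreover have "int (\<Sum>P) \<ge> 0" "int (\<Sum>(T - P)) \<ge> 0" by (rule of_nat_0_le_iff)+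
    ultimately show "signed_sum (T, P) \<in> {- int ((k - m) * n)..int (m * n)}"
      unfolding signed_sum_eq[OF T(5,3)] atLeastAtMost_iff by linarith
  qed
  then have "card (split_subsets A k m) \<le> card {- int ((k - m) * n)..int (m * n)}"
    using inj_on_signed_sum[OF B mk] by (intro card_inj_on_le) auto
  also have "\<dots> = k * n + 1"
  proof -
    have "int (m * n) - - int ((k - m) * n) + 1 = int (k * n + 1)"
      using mk by (simp add: of_nat_diff algebra_simps)
    then show ?thesis by (simp only: card_atLeastAtMost_int nat_int diff_add_eq) 
  qed
  finally show ?thesis using fin by (simp add: card_split_subsets)
qed

section \<open>Second-moment bound for the differences\<close>

text \<open>The squared deviations of the differences from \<open>c\<close> are bounded below by
  distinctness and above by averaging signs for each \<open>T\<close>. Assumption \<open>CD\<close>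
  says that the signs are not positively correlated.\<close>

lemma card_signed_sums_square_le:
  assumes B: "B_seq k A" and A: "A \<subseteq> {0..n}" and m: "1 \<le> m" "m \<le> k"
    and CD: "k choose m \<le> 4 * ((k - 2) choose (m - 1))" and ak: "k \<le> card A"
  defines "N \<equiv> (card A choose k) * (k choose m)"
  shows "real (k choose m) * ((real N)\<^sup>2 - 1) \<le> 12 * real ((k - 2) choose (m - 1)) * real k * (real n)\<^sup>2"
proof -
  define D where "D = 4 * real ((k - 2) choose (m - 1))"
  \<comment> \<open>Translating \<open>A\<close> by \<open>-n/2\<close> shifts every signed sum by
    this same amount, as \<open>P\<close> has \<open>m\<close> elements and \<open>T - P\<close> has
    \<open>k - m\<close>.\<close>
  define c where "c = (2 * real m - real k) * (real n / 2)"
  define x where "x = (\<lambda>a. real a - real n / 2)"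
  have fin: "finite A" using B by (simp add: B_seq_def)
  let ?S = "split_subsets A k m"
  let ?TT = "{T. T \<subseteq> A \<and> card T = k}"
  have card: "card (signed_sum ` ?S) = N"
    using inj_on_signed_sum[OF B m(2)] card_split_subsets[OF fin] by (simp add: card_image N_def)
  have "real N * ((real N)\<^sup>2 - 1) / 12 \<le> (\<Sum>s\<in>signed_sum ` ?S. (real_of_int s - c)\<^sup>2)"
    using sum_square_distinct_integers_ge[of "signed_sum ` ?S" c] finite_split_subsets[OF fin] card
    by simp
  also have "\<dots> = (\<Sum>u\<in>?S. (real_of_int (signed_sum u) - c)\<^sup>2)"
    using inj_on_signed_sum[OF B m(2)] by (simp add: sum.reindex)
  also have "\<dots> = (\<Sum>T\<in>?TT. \<Sum>P\<in>{P. P \<subseteq> T \<and> card P = m}. (real_of_int (signed_sum (T, P)) - c)\<^sup>2)"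
    unfolding split_subsets_def using fin
    by (subst sum.Sigma) (auto simp: finite_subset)
  also have "\<dots> \<le> (\<Sum>T\<in>?TT. D * (real k * (real n / 2)\<^sup>2))"
  proof (rule sum_mono)
    fix T assume "T \<in> ?TT"
    then have T: "T \<subseteq> A" "card T = k" "finite T" using fin by (auto intro: finite_subset)
    have "(\<Sum>P\<in>{P. P \<subseteq> T \<and> card P = m}. (real_of_int (signed_sum (T, P)) - c)\<^sup>2) =
        (\<Sum>P\<in>{P. P \<subseteq> T \<and> card P = m}. (2 * sum x P - sum x T)\<^sup>2)"
      using T by (intro sum.cong refl)
        (auto simp: signed_sum_def x_def c_def sum_subtractf algebra_simps)
    also have "\<dots> = D * (\<Sum>i\<in>T. (x i)\<^sup>2) + (real (k choose m) - D) * (sum x T)\<^sup>2"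
      using sum_square_signed_sums[OF T(3) m(1), of x] T(2) by (simp add: D_def)
    also have "\<dots> \<le> D * (\<Sum>i\<in>T. (x i)\<^sup>2)"
    proof -
      have "real (k choose m) \<le> D" using CD unfolding D_def by linarith
      then show ?thesis by (simp add: mult_nonpos_nonneg)
    qed
    also have "\<dots> \<le> D * (real k * (real n / 2)\<^sup>2)"
    proof (rule mult_left_mono)
      have "(x i)\<^sup>2 \<le> (real n / 2)\<^sup>2" if "i \<in> T" for i
      proof -
        have "i \<le> n" using that T A by auto
        then have "\<bar>x i\<bar> \<le> real n / 2" unfolding x_def by linarith
        then have "\<bar>x i\<bar>\<^sup>2 \<le> (real n / 2)\<^sup>2" by (intro power_mono) auto
        then show ?thesis by simp
      qed
      then show "(\<Sum>i\<in>T. (x i)\<^sup>2) \<le> real k * (real n / 2)\<^sup>2"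
        using sum_bounded_above[of T "\<lambda>i. (x i)\<^sup>2" "(real n / 2)\<^sup>2"] T by simp
    qed (simp add: D_def)
    finally show "(\<Sum>P\<in>{P. P \<subseteq> T \<and> card P = m}. (real_of_int (signed_sum (T, P)) - c)\<^sup>2)
        \<le> D * (real k * (real n / 2)\<^sup>2)" .
  qed
  also have "\<dots> = real (card A choose k) * (D * (real k * (real n / 2)\<^sup>2))"
    using fin by (simp add: n_subsets)
  finally have "real (card A choose k) * (real (k choose m) * ((real N)\<^sup>2 - 1)) \<le>
      real (card A choose k) * (12 * real ((k - 2) choose (m - 1)) * real k * (real n)\<^sup>2)"
    by (simp add: D_def N_def power_divide field_simps)
  then show ?thesis using ak by (simp add: mult_le_cancel_left_pos)
qed

section \<open>Balanced splittings and sets with at least k elements\<close>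

text \<open>Two absorption identities in a row: \<open>m\<close> lowers both entries of the
  coefficient, then \<open>k - m\<close> lowers the upper one.\<close>

lemma binomial_split_ratio:
  assumes "1 \<le> m" "m \<le> k"
  shows "m * (k - m) * (k choose m) = k * (k - 1) * ((k - 2) choose (m - 1))"
proof -
  obtain i where i: "m = Suc i" using assms by (cases m) auto
  obtain j where j: "k = Suc j" using assms by (cases k) auto
  have "m * (k - m) * (k choose m) = (j - i) * (Suc i * (Suc j choose Suc i))"
    unfolding i j by (simp only: diff_Suc_Suc mult_ac)
  also have "\<dots> = Suc j * ((j - i) * (j choose i))"
    by (simp only: Suc_times_binomial mult_ac)
  also have "\<dots> = k * (k - 1) * ((k - 2) choose (m - 1))"
    unfolding binomial_absorb_comp by (simp add: i j distrib_right)
  finally show ?thesis .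
qed

text \<open>Through \<open>binomial_split_ratio\<close>, the first bound makes the signs
  nonpositively correlated and the second controls the moment bound. At \<open>k = 2\<close> the
  second would read \<open>3 \<le> 2\<close>.\<close>

lemma half_product_bounds:
  fixes k :: nat
  assumes "k \<ge> 3"
  shows "k * (k - 1) \<le> 4 * (k div 2 * (k - k div 2))"
    and "3 * (k div 2 * (k - k div 2)) \<le> 2 * ((k + 1) div 2) * (k - 1)"
proof -
  have "k * (k - 1) \<le> 4 * (k div 2 * (k - k div 2)) \<and>
    3 * (k div 2 * (k - k div 2)) \<le> 2 * ((k + 1) div 2) * (k - 1)"
  proof (cases "even k")
    case True
    then obtain m where m: "k = 2 * m" by blast
    then obtain i where "m = Suc (Suc i)" using assms
      by (metis One_nat_def Suc_1 Suc_leD mult_is_0 nat_mult_1_right not0_implies_Suc not_less_eq_eq numeral_3_eq_3 zero_le)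
    with m show ?thesis by (simp add: algebra_simps)
  next
    case False
    then obtain m where m: "k = 2 * m + 1" by (elim oddE)
    then show ?thesis by (simp add: algebra_simps)
  qed
  then show "k * (k - 1) \<le> 4 * (k div 2 * (k - k div 2))"
    and "3 * (k div 2 * (k - k div 2)) \<le> 2 * ((k + 1) div 2) * (k - 1)" by auto
qed

lemma two_power_choose_le:
  assumes B: "B_seq k A" and A: "A \<subseteq> {0..n}" and k: "k \<ge> 1" and n: "n \<ge> 1"
    and ak: "k \<le> card A"
  shows "2 ^ k * real (card A choose k) \<le> 6 * real ((k + 1) div 2) * real n"
proof (cases "k \<le> 2")
  case True
  then have k12: "k = 1 \<or> k = 2" using k by linarith
  have "(card A choose k) * (k choose (k div 2)) \<le> k * n + 1"
    by (rule card_signed_sums_le[OF B A]) simp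
  \<comment> \<open>Here \<open>2 ^ k = 2 * (k choose (k div 2))\<close> for both values of
    \<open>k\<close>.\<close>
  then have "2 ^ k * (card A choose k) \<le> 2 * (k * n + 1)"
    using k12 by (auto simp: numeral_2_eq_2)
  also have "\<dots> \<le> 6 * ((k + 1) div 2) * n"
    using k12 n by auto
  finally have "real (2 ^ k * (card A choose k)) \<le> real (6 * ((k + 1) div 2) * n)"
    by (simp only: of_nat_le_iff)
  then show ?thesis by simp
next
  case False
  then have k3: "k \<ge> 3" by simp
  define m h where "m = k div 2" and "h = (k + 1) div 2"
  define C E where "C = k choose m" and "E = (k - 2) choose (m - 1)"
  define b where "b = real (card A choose k)"
  have m: "1 \<le> m" "m \<le> k" using k3 by (auto simp: m_def)
  have ratio: "m * (k - m) * C = k * (k - 1) * E"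
    unfolding C_def E_def by (rule binomial_split_ratio[OF m])
  have C0: "C > 0" using m by (simp add: C_def)
  have h1: "h \<ge> 1" using k by (simp add: h_def)
  have "k * (k - 1) * C \<le> 4 * (m * (k - m)) * C"
    using half_product_bounds(1)[OF k3] unfolding m_def by (rule mult_right_mono) simp
  also have "\<dots> = k * (k - 1) * (4 * E)" using ratio by (simp add: mult_ac)
  finally have CE: "C \<le> 4 * E" using k3 by simp
  define N where "N = b * real C"
  have moment: "real C * (N\<^sup>2 - 1) \<le> 12 * real E * real k * (real n)\<^sup>2"
    using card_signed_sums_square_le[OF B A m CE[unfolded C_def E_def] ak]
    by (simp add: C_def E_def N_def b_def)
  \<comment> \<open>After \<open>ratio\<close> replaces \<open>k * (k - 1) * E\<close> by
    \<open>m * (k - m) * C\<close>, the bound \<open>3 * m * (k - m) \<le> 2 * h * (k - 1)\<close>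
    turns 12 into 8.\<close>
  have "N\<^sup>2 - 1 \<le> 8 * real h * (real n)\<^sup>2"
  proof -
    have rr: "real m * real (k - m) * real C = real k * real (k - 1) * real E"
      using arg_cong[OF ratio, of real] by simp
    have "real C * real (k - 1) * (N\<^sup>2 - 1) \<le> real (k - 1) * (12 * real E * real k * (real n)\<^sup>2)"
      using mult_left_mono[OF moment, of "real (k - 1)"] by (simp only: mult_ac of_nat_0_le_iff)
    also have "\<dots> = 12 * (real k * real (k - 1) * real E) * (real n)\<^sup>2"
      by (simp only: mult_ac)
    also have "\<dots> = real C * (4 * real (3 * (m * (k - m))) * (real n)\<^sup>2)"
      unfolding rr[symmetric] by simp
    also have "\<dots> \<le> real C * (4 * real (2 * h * (k - 1)) * (real n)\<^sup>2)"
      using half_product_bounds(2)[OF k3] unfolding m_def h_def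
      by (intro mult_left_mono mult_right_mono) (simp_all only: of_nat_le_iff, auto)
    also have "\<dots> = real C * real (k - 1) * (8 * real h * (real n)\<^sup>2)"
      by simp
    finally show ?thesis using C0 k3 by simp
  qed
  then have N2: "N\<^sup>2 \<le> 8 * real h * (real n)\<^sup>2 + 1" by simp
  have "(2 ^ k * b)\<^sup>2 = 4 ^ k * b\<^sup>2"
    by (simp add: power_mult_distrib power2_eq_square flip: power_mult_distrib)
  also have "\<dots> \<le> (4 * real h * (real C)\<^sup>2) * b\<^sup>2"
    using middle_binomial_square_ge[OF k] unfolding h_def C_def m_def
    by (intro mult_right_mono) auto
  also have "\<dots> = 4 * real h * N\<^sup>2" by (simp add: N_def power_mult_distrib)
  also have "\<dots> \<le> 4 * real h * (8 * real h * (real n)\<^sup>2 + 1)"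
    using N2 by (intro mult_left_mono) auto
  \<comment> \<open>The square supplies 36 against 32 on the left; the surplus absorbs
    \<open>4 * h\<close> because \<open>1 \<le> h * n^2\<close>.\<close>
  also have "\<dots> \<le> (6 * real h * real n)\<^sup>2"
  proof -
    have "1 * 1 \<le> real h * (real n)\<^sup>2"
      using h1 n by (intro mult_mono) auto
    then have "4 * real h * 1 \<le> 4 * real h * (real h * (real n)\<^sup>2)"
      by (intro mult_left_mono) auto
    then show ?thesis by (simp add: power2_eq_square algebra_simps)
  qed
  finally show ?thesis unfolding b_def h_def by (rule power2_le_imp_le) simp
qed

section \<open>Sets with fewer than k elements\<close>

text \<open>The multiset count is at least \<open>(k + h) choose k\<close> once
  \<open>card A > h\<close>, and \<open>two_power_le_binomial\<close> bounds that from below. The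
  ratio 3/5 is a rational stand-in for \<open>1 - 1/e\<close>.\<close>

lemma two_power_le_of_large_card:
  assumes B: "B_seq k A" and A: "A \<subseteq> {0..n}" and n: "n \<ge> 1"
    and a: "3 * k < 5 * card A" and ak: "card A < k"
  shows "2 ^ k \<le> 6 * ((k + 1) div 2) * n"
proof (cases "k \<le> 3")
  case True
  then have "k = 0 \<or> k = 1 \<or> k = 2 \<or> k = 3" by linarith
  \<comment> \<open>For \<open>k \<le> 2\<close> no cardinality fits both bounds; for
    \<open>k = 3\<close> the claim is \<open>8 \<le> 12 * n\<close>.\<close>
  then show ?thesis using n a ak by auto
next
  case False
  define h where "h = (k + 1) div 2"
  have h: "h \<le> k" "k \<le> 2 * h" using False by (auto simp: h_def)
  \<comment> \<open>The extra 1 offsets the \<open>- 1\<close> in the multiset count. This fails at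
    \<open>k = 3\<close>, \<open>card A = 2\<close>.\<close>
  have ha: "h + 1 \<le> card A" using a False unfolding h_def by presburger
  have "2 ^ k \<le> 2 * ((k + h) choose h)" by (rule two_power_le_binomial[OF h])
  also have "(k + h) choose h = (k + h) choose k"
    by (subst binomial_symmetric) auto
  also have "2 * \<dots> \<le> 2 * ((card A + k - 1) choose k)"
    using ha by (intro mult_left_mono binomial_right_mono) auto
  also have "\<dots> \<le> 2 * (k * n + 1)"
    using card_multisets_le[OF B A] by simp
  finally have 1: "2 ^ k \<le> 2 * (k * n) + 2" by simp
  have "4 * 1 \<le> k * n" using False n by (intro mult_le_mono) auto
  with 1 have "2 ^ k \<le> 3 * (k * n)" by linarith
  also have "\<dots> \<le> 3 * (2 * h * n)" using h by simp
  finally show ?thesis by (simp add: h_def mult_ac)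
qed

section \<open>Numerical constants and the final bound\<close>

text \<open>Four terms of the series. The value yields both \<open>1 - 1/e \<ge> 3/5\<close> and,
  with \<open>pi > 3\<close>, \<open>e * pi^2 \<ge> 24\<close>.\<close>

lemma exp_1_ge: "8 / 3 \<le> exp (1::real)"
proof -
  have "(\<Sum>n<4. inverse (fact n)) \<le> (\<Sum>n. inverse (fact n) :: real)"
    using summable_exp[of "1::real"] by (intro sum_le_suminf) auto
  then show ?thesis by (simp add: exp_def fact_numeral eval_nat_numeral)
qed

lemma card_B_seq_power_le:
  assumes B: "B_seq k A" and A: "A \<subseteq> {0..n}" and k: "k \<ge> 1" and n: "n \<ge> 1"
    and pos: "real (card A) > (exp 1 - 1) / exp 1 * real k"
  shows "(real (card A) - (exp 1 - 1) / exp 1 * real k) ^ k \<le>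
     exp 1 * pi\<^sup>2 * real ((k + 1) div 2) * fact k / 2 ^ (k + 2) * real n"
proof -
  define h where "h = (k + 1) div 2"
  \<comment> \<open>This exposes the base of \<open>rising_product_ge\<close> with
    \<open>y = card A - k\<close>.\<close>
  have shift: "real (card A) - (exp 1 - 1) / exp 1 * real k = real (card A) - real k + real k / exp 1"
    by (simp add: field_simps)
  have key: "2 ^ k * (real (card A) - (exp 1 - 1) / exp 1 * real k) ^ k \<le> fact k * (6 * real h * real n)"
  proof (cases "k \<le> card A")
    case True
    then have "(real (card A) - (exp 1 - 1) / exp 1 * real k) ^ k \<le> fact k * real (card A choose k)"
      using rising_product_ge[of "card A - k" k] unfolding shift by (simp add: of_nat_diff)
    then have "2 ^ k * (real (card A) - (exp 1 - 1) / exp 1 * real k) ^ k \<le>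
        fact k * (2 ^ k * real (card A choose k))"
      by (simp add: mult.left_commute)
    also have "\<dots> \<le> fact k * (6 * real h * real n)"
      using two_power_choose_le[OF B A k n True] unfolding h_def by (intro mult_left_mono) auto
    finally show ?thesis .
  next
    case False
    have "(3 / 5) * real k \<le> (exp 1 - 1) / exp 1 * real k"
      using exp_1_ge by (intro mult_right_mono) (auto simp: field_simps)
    then have "3 * k < 5 * card A" using pos by linarith
    then have "2 ^ k \<le> 6 * h * n"
      using two_power_le_of_large_card[OF B A n] False unfolding h_def by simp
    then have "real (2 ^ k) \<le> real (6 * h * n)" by (simp only: of_nat_le_iff)
    moreover have "(real (card A) - (exp 1 - 1) / exp 1 * real k) ^ k \<le> (real k / exp 1) ^ k"
      using pos False shift by (intro power_mono) auto
    \<comment> \<open>The case \<open>y = 0\<close> of the rising product bound.\<close>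
    moreover have "(real k / exp 1) ^ k \<le> fact k" using rising_product_ge[of 0 k] by simp
    ultimately have "2 ^ k * (real (card A) - (exp 1 - 1) / exp 1 * real k) ^ k \<le> (6 * real h * real n) * fact k"
      using pos by (intro mult_mono) auto
    then show ?thesis by (simp add: mult_ac)
  qed
  \<comment> \<open>The target 24 is the 6 of \<open>key\<close> times the extra factor 4 in
    \<open>2 ^ (k + 2)\<close>.\<close>
  have "8 / 3 * 3\<^sup>2 \<le> exp 1 * pi\<^sup>2"
    using exp_1_ge pi_gt3 by (intro mult_mono power_mono) auto
  then have "24 * (fact k * (real h * real n)) \<le> exp 1 * pi\<^sup>2 * (fact k * (real h * real n))"
    by (intro mult_right_mono) auto
  with key have "4 * (2 ^ k * (real (card A) - (exp 1 - 1) / exp 1 * real k) ^ k) \<le>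
      exp 1 * pi\<^sup>2 * (fact k * (real h * real n))" by linarith
  then show ?thesis unfolding h_def by (simp add: field_simps)
qed

lemma Phi_attained:
  obtains A where "A \<subseteq> {0..n}" "B_seq k A" "card A = Phi k n"
proof -
  let ?S = "{card A | A. A \<subseteq> {0..n} \<and> B_seq k A}"
  have "?S \<subseteq> card ` Pow {0..n}" by auto
  then have "finite ?S" by (rule finite_subset) auto
  moreover have "card {} \<in> ?S" by (auto simp: B_seq_def intro!: exI[of _ "{}"])
  ultimately have "Phi k n \<in> ?S" unfolding Phi_def by (intro Max_in) auto
  then show ?thesis using that by auto
qed

theorem theorem5:
  fixes k n :: nat
  assumes "k \<ge> 1" and "n \<ge> 1"
  shows "real (Phi k n) \<le>
    (exp 1 * pi^2 * real ((k + 1) div 2) * fact k / 2^(k+2)) powr (1 / real k) * real n powr (1 / real k)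
    + (exp 1 - 1) / exp 1 * real k"
proof -
  obtain A where A: "A \<subseteq> {0..n}" "B_seq k A" "card A = Phi k n" by (rule Phi_attained)
  define X where "X = exp 1 * pi^2 * real ((k + 1) div 2) * fact k / 2^(k+2)"
  define t where "t = real (card A) - (exp 1 - 1) / exp 1 * real k"
  have X: "X \<ge> 0" by (simp add: X_def)
  have "t \<le> X powr (1 / real k) * real n powr (1 / real k)"
  \<comment> \<open>Taking \<open>k\<close>-th roots needs \<open>t > 0\<close>; otherwise the
    nonnegative right side suffices.\<close>
  proof (cases "t > 0")
    case True
    then have "t ^ k \<le> X * real n"
      unfolding t_def X_def by (intro card_B_seq_power_le[OF A(2,1) assms]) simp
    moreover have "t = (t ^ k) powr (1 / real k)"
      using True assms by (simp add: powr_powr flip: powr_realpow)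
    ultimately have "t \<le> (X * real n) powr (1 / real k)"
      using True by (metis powr_mono2 zero_le_divide_1_iff of_nat_0_le_iff zero_le_power less_imp_le)
    then show ?thesis using X by (simp add: powr_mult)
  next
    case False
    then show ?thesis by (meson dual_order.trans linorder_not_less mult_nonneg_nonneg powr_ge_zero)
  qed
  then show ?thesis using A(3) unfolding t_def X_def by simp
qed

end
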